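(* For $N\ge 3$ let $\tilde{\mathcal{F}}_N=\{e_j\}_{j=1}^N$ be the harmonic frame of $\mathbb{R}^2$, $e_j=[\cos(2j\pi/N),\sin(2j\pi/N)]^T$. Let $r>0$, $\delta>0$ satisfy $$\int_{-\pi}^{\pi}\Delta_\delta(r\cos\theta)\cos\theta\,d\theta=0.$$ Then $\mathcal{E}_\delta(r,\tilde{\mathcal{F}}_N)=O(1/N)$ as $N\to\infty$ (with implied constant depending on $r,\delta$). In particular, this condition holds when $$\frac{r}{\delta}=\frac{\sqrt{8-2\sqrt{16-\pi^2}}}{\pi}.$$
   Context: For $\delta>0$, $Q_\delta(t):=\delta\lfloor t/\delta+1/2\rfloor$ and $\Delta_\delta(t):=t-Q_\delta(t)$. For a unit-norm tight frame $\mathcal{F}=\{e_j\}_{j=1}^N$ of $\mathbb{R}^2$ (i.e. $\|e_j\|=1$, $\sum_j e_je_j^T=\frac N2 I_2$), $E_\delta(x,\mathcal{F}):=\bigl\|x-\frac{2}{N}\sum_{j=1}^N Q_\delta(\langle x,e_j\rangle)e_j\bigr\|$. For $r>0$ set $x_\psi:=r[\cos\psi,\sin\psi]^T$ and $\mathcal{E}_\delta(r,\mathcal{F}):=\bigl(\int_0^{2\pi}E_\delta(x_\psi,\mathcal{F})^2\,d\psi\bigr)^{1/2}$. *)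

theory Defs
  imports "HOL-Analysis.Analysis" "HOL-Library.Landau_Symbols"
begin

definition Qd :: "real \<Rightarrow> real \<Rightarrow> real" where
  "Qd \<delta> t = \<delta> * of_int \<lfloor>t / \<delta> + 1/2\<rfloor>"

definition Dd :: "real \<Rightarrow> real \<Rightarrow> real" where
  "Dd \<delta> t = t - Qd \<delta> t"

definition harmonic_frame :: "nat \<Rightarrow> nat \<Rightarrow> real^2" where
  "harmonic_frame N j = vector [cos (2 * real j * pi / real N), sin (2 * real j * pi / real N)]"

definition frame_err :: "real \<Rightarrow> real^2 \<Rightarrow> nat \<Rightarrow> (nat \<Rightarrow> real^2) \<Rightarrow> real" where
  "frame_err \<delta> x N e =
     norm (x - (2 / real N) *\<^sub>R (\<Sum>j = 1..N. Qd \<delta> (x \<bullet> e j) *\<^sub>R e j))"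

definition polar_pt :: "real \<Rightarrow> real \<Rightarrow> real^2" where
  "polar_pt r \<psi> = vector [r * cos \<psi>, r * sin \<psi>]"

definition circle_err :: "real \<Rightarrow> real \<Rightarrow> nat \<Rightarrow> (nat \<Rightarrow> real^2) \<Rightarrow> real" where
  "circle_err \<delta> r N e =
     sqrt (integral {0..2*pi} (\<lambda>\<psi>. (frame_err \<delta> (polar_pt r \<psi>) N e)\<^sup>2))"

end

(* Put u_j = 2 j pi / N - psi. Rotating by psi turns the two coordinates of the error into
   r - (2/N) sum_j Q(r cos u_j) cos u_j  and  (2/N) sum_j Q(r cos u_j) sin u_j.
   Both sums are Riemann sums, with step 2 pi / N over one period, of functions of bounded variation,
   so they are within O(1/N) of their integrals, uniformly in psi. The sine integral vanishes because
   the integrand is odd; the cosine integral is r pi exactly under the hypothesis.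
   For delta/2 < r < 3 delta/2 the quantizer takes only the values -delta, 0, delta on the circle, and
   the hypothesis becomes pi s = 4 sqrt (1 - 1/(4 s^2)) for s = r/delta, a quadratic equation in s^2
   whose smaller root is the square of the stated ratio. *)

theory Submission
  imports Defs
begin

section \<open>Majorants of the variation\<close>

text \<open>The growth of \<open>H\<close> dominates that of the total variation of \<open>f\<close>: such an \<open>H\<close> exists
  iff \<open>f\<close> has bounded variation on \<open>[a, b]\<close>.\<close>
definition variation_majorant :: "(real \<Rightarrow> real) \<Rightarrow> (real \<Rightarrow> real) \<Rightarrow> real \<Rightarrow> real \<Rightarrow> bool" where
  "variation_majorant f H a b \<longleftrightarrow> (\<forall>x y. a \<le> x \<longrightarrow> x \<le> y \<longrightarrow> y \<le> b \<longrightarrow> \<bar>f x - f y\<bar> \<le> H y - H x)"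

lemma variation_majorantD:
  "variation_majorant f H a b \<Longrightarrow> a \<le> x \<Longrightarrow> x \<le> y \<Longrightarrow> y \<le> b \<Longrightarrow> \<bar>f x - f y\<bar> \<le> H y - H x"
  by (auto simp: variation_majorant_def)

lemma variation_majorant_mono:
  assumes "variation_majorant f H a b" "a \<le> x" "x \<le> y" "y \<le> b"
  shows "H x \<le> H y"
  using variation_majorantD[OF assms] by linarith

text \<open>Only increments of a majorant matter, so \<open>K\<close> is shifted by a constant to
  agree with \<open>H\<close> at \<open>b\<close>; for points on opposite sides of \<open>b\<close>
  the triangle inequality through \<open>f b\<close> suffices.\<close>

lemma variation_majorant_concat:
  assumes "variation_majorant f H a b" "variation_majorant f K b c" "a \<le> b" "b \<le> c"
  shows "variation_majorant f (\<lambda>x. if x \<le> b then H x else H b + (K x - K b)) a c"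
  unfolding variation_majorant_def
proof (intro allI impI)
  fix x y assume xy: "a \<le> x" "x \<le> y" "y \<le> c"
  let ?G = "\<lambda>x. if x \<le> b then H x else H b + (K x - K b)"
  consider "y \<le> b" | "b < x" | "x \<le> b" "b < y" by linarith
  then show "\<bar>f x - f y\<bar> \<le> ?G y - ?G x"
  proof cases
    case 1
    then show ?thesis using variation_majorantD[OF assms(1), of x y] xy by auto
  next
    case 2
    then show ?thesis using variation_majorantD[OF assms(2), of x y] xy by auto
  next
    case 3
    then have "\<bar>f x - f b\<bar> \<le> H b - H x" "\<bar>f b - f y\<bar> \<le> K y - K b"
      using variation_majorantD[OF assms(1), of x b] variation_majorantD[OF assms(2), of b y] xy assms
      by auto
    then show ?thesis using 3 by auto
  qed
qed

text \<open>The product difference splits as \<open>(f x - f y) * g x + f y * (g x - g y)\<close>: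
  the first term is controlled by \<open>H\<close>, the second by slope \<open>M\<close>. Intended
  for \<open>g\<close> = \<open>cos\<close> and \<open>g\<close> = \<open>sin\<close>.\<close>

lemma variation_majorant_mult_lipschitz:
  assumes H: "variation_majorant f H a b"
    and M: "\<And>x. \<bar>f x\<bar> \<le> M"
    and g: "\<And>x. \<bar>g x\<bar> \<le> 1" "\<And>x y. \<bar>g x - g y\<bar> \<le> \<bar>x - y\<bar>"
  shows "variation_majorant (\<lambda>x. f x * g x) (\<lambda>x. H x + M * x) a b"
  unfolding variation_majorant_def
proof (intro allI impI)
  fix x y assume xy: "a \<le> x" "x \<le> y" "y \<le> b"
  have "\<bar>f x * g x - f y * g y\<bar> = \<bar>(f x - f y) * g x + f y * (g x - g y)\<bar>"
    by (simp add: algebra_simps)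
  also have "\<dots> \<le> \<bar>f x - f y\<bar> * \<bar>g x\<bar> + \<bar>f y\<bar> * \<bar>g x - g y\<bar>"
    by (metis abs_mult abs_triangle_ineq)
  also have "\<dots> \<le> (H y - H x) * 1 + M * \<bar>x - y\<bar>"
    using variation_majorantD[OF H xy] M[of y] g[of x] g(2)[of x y]
    by (intro add_mono mult_mono) auto
  finally show "\<bar>f x * g x - f y * g y\<bar> \<le> (H y + M * y) - (H x + M * x)"
    using xy by (simp add: algebra_simps)
qed

section \<open>Riemann sums and integrals over a period\<close>

text \<open>On each cell the right endpoint value differs from \<open>f\<close> by at most the
  growth of \<open>H\<close> there, so the cell error is at most \<open>h\<close> times that growth.
  The growths telescope; the induction splits off the last cell \<open>{c..d}\<close>.\<close>

lemma riemann_sum_error: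
  fixes f H :: "real \<Rightarrow> real"
  assumes "h \<ge> 0" "variation_majorant f H a (a + real N * h)" "f integrable_on {a..a + real N * h}"
  shows "\<bar>h * (\<Sum>j=1..N. f (a + real j * h)) - integral {a..a + real N * h} f\<bar>
           \<le> h * (H (a + real N * h) - H a)"
  using assms(2,3)
proof (induction N)
  case 0
  then show ?case by simp
next
  case (Suc N)
  define c d where "c = a + real N * h" and "d = a + real (Suc N) * h"
  have cd: "a \<le> c" "c \<le> d" "d - c = h"
    using assms(1) by (auto simp: c_def d_def algebra_simps)
  note vm = Suc.prems(1)[folded d_def] and int = Suc.prems(2)[folded d_def]
  have vm': "variation_majorant f H a c"
    using vm cd by (auto simp: variation_majorant_def)
  have int': "f integrable_on {a..c}" "f integrable_on {c..d}"
    using int cd by (auto intro: integrable_subinterval_real)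
  have IH: "\<bar>h * (\<Sum>j=1..N. f (a + real j * h)) - integral {a..c} f\<bar> \<le> h * (H c - H a)"
    using Suc.IH vm' int' unfolding c_def by blast
  have comb: "integral {a..c} f + integral {c..d} f = integral {a..d} f"
    using Henstock_Kurzweil_Integration.integral_combine[OF cd(1,2) int] .
  \<comment> \<open>The error of the last cell is itself an integral, of \<open>f d - f x\<close>,
    and can be bounded pointwise.\<close>
  have "((\<lambda>x. f d - f x) has_integral (h * f d - integral {c..d} f)) {c..d}"
    using has_integral_diff[OF has_integral_const_real[of "f d" c d] integrable_integral[OF int'(2)]] cd
    by simp
  moreover have "norm (f d - f x) \<le> H d - H c" if "x \<in> {c..d}" for x
    using variation_majorantD[OF vm, of x d] variation_majorant_mono[OF vm, of c x] that cd by auto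
  moreover have "0 \<le> H d - H c" using variation_majorant_mono[OF vm, of c d] cd by auto
  ultimately have "norm (h * f d - integral {c..d} f) \<le> (H d - H c) * measure lborel {c..d}"
    by (intro has_integral_bound_real[where S = "{}"]) auto
  then have "\<bar>h * f d - integral {c..d} f\<bar> \<le> h * (H d - H c)"
    using cd by (simp add: mult.commute)
  then have "\<bar>h * ((\<Sum>j=1..N. f (a + real j * h)) + f d) - integral {a..d} f\<bar> \<le> h * (H d - H a)"
    using IH comb by (simp add: algebra_simps abs_le_iff) 
  then show ?case by (simp add: d_def)
qed

text \<open>The piece \<open>{a..b}\<close> lost on the left returns, shifted by \<open>p\<close>,
  on the right. The argument covers moves to the right by at most one period.\<close>

lemma integral_periodic_window:
  fixes f :: "real \<Rightarrow> real"
  assumes per: "\<And>x. f (x + p) = f x" and int: "\<And>a b. f integrable_on {a..b}"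
    and ab: "a \<le> b" "b \<le> a + p"
  shows "integral {b..b + p} f = integral {a..a + p} f"
proof -
  have "integral {a..b} f + integral {b..a + p} f = integral {a..a + p} f"
    using Henstock_Kurzweil_Integration.integral_combine[OF ab int] .
  moreover have "integral {b..a + p} f + integral {a + p..b + p} f = integral {b..b + p} f"
    using Henstock_Kurzweil_Integration.integral_combine[OF ab(2) _ int] ab by auto
  moreover have "integral {a + p..b + p} f = integral {a..b} f"
    using integral_shift_real_ivl[of "a + p" p "b + p" f] per by simp
  ultimately show ?thesis by linarith
qed

section \<open>The quantizer along the circle\<close>

lemma Qd_mono: "\<delta> > 0 \<Longrightarrow> s \<le> t \<Longrightarrow> Qd \<delta> s \<le> Qd \<delta> t"
  unfolding Qd_def by (intro mult_left_mono) (auto intro!: floor_mono divide_right_mono)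

lemma Qd_abs_le: assumes "\<delta> > 0" shows "\<bar>Qd \<delta> t\<bar> \<le> \<bar>t\<bar> + \<delta>"
proof -
  have "t / \<delta> - 1 \<le> of_int \<lfloor>t / \<delta> + 1/2\<rfloor>" "of_int \<lfloor>t / \<delta> + 1/2\<rfloor> \<le> t / \<delta> + 1"
    by linarith+
  then have "\<delta> * (t / \<delta> - 1) \<le> Qd \<delta> t" "Qd \<delta> t \<le> \<delta> * (t / \<delta> + 1)"
    using assms unfolding Qd_def by (auto intro!: mult_left_mono)
  then have "\<bar>Qd \<delta> t - t\<bar> \<le> \<delta>"
    using assms by (simp add: algebra_simps abs_le_iff)
  then show ?thesis by linarith
qed

lemma Qd_cos_abs_le: assumes "\<delta> > 0" "r > 0" shows "\<bar>Qd \<delta> (r * cos u)\<bar> \<le> r + \<delta>"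
proof -
  have "\<bar>r * cos u\<bar> \<le> r" using assms by (simp add: abs_mult)
  then show ?thesis using Qd_abs_le[OF assms(1), of "r * cos u"] by linarith
qed

lemma Qd_measurable [measurable]: "Qd \<delta> \<in> borel_measurable borel"
  unfolding Qd_def by measurable

lemma Qd_cos_mult_integrable:
  assumes "\<delta> > 0" "r > 0" and g: "g \<in> borel_measurable borel" "\<And>x. \<bar>g x\<bar> \<le> 1"
  shows "(\<lambda>u. Qd \<delta> (r * cos u) * g u) integrable_on {a..b}"
proof (rule measurable_bounded_by_integrable_imp_integrable_real)
  note g(1)[measurable]
  have "(\<lambda>u. Qd \<delta> (r * cos u) * g u) \<in> borel_measurable borel" by measurable
  then show "(\<lambda>u. Qd \<delta> (r * cos u) * g u) \<in> borel_measurable (lebesgue_on {a..b})"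
    by (intro measurable_restrict_space1 measurable_completion) auto
  show "(\<lambda>_. r + \<delta>) integrable_on {a..b}" by auto
  show "\<bar>Qd \<delta> (r * cos u) * g u\<bar> \<le> r + \<delta>" for u
    using mult_mono[OF Qd_cos_abs_le[OF assms(1,2)] g(2)[of u]] assms by (simp add: abs_mult)
qed auto

lemma antimono_variation_majorant:
  "(\<And>x y. a \<le> x \<Longrightarrow> x \<le> y \<Longrightarrow> y \<le> b \<Longrightarrow> f y \<le> f x) \<Longrightarrow> variation_majorant f (\<lambda>x. - f x) a b"
  by (force simp: variation_majorant_def)

lemma mono_variation_majorant:
  "(\<And>x y. a \<le> x \<Longrightarrow> x \<le> y \<Longrightarrow> y \<le> b \<Longrightarrow> f x \<le> f y) \<Longrightarrow> variation_majorant f f a b"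
  by (force simp: variation_majorant_def)

text \<open>Since \<open>Qd\<close> is monotone, the composition is monotone on each of four
  intervals of length \<open>pi\<close>, where plus or minus the function is its own majorant; the
  four are glued. The range contains every window from \<open>-\<psi>\<close> to
  \<open>-\<psi> + 2*pi\<close> with \<open>0 \<le> \<psi> \<le> 2*pi\<close>, so one
  \<open>H\<close> serves all \<open>\<psi>\<close>.\<close>

lemma Qd_cos_majorant:
  assumes "\<delta> > 0" "r > 0"
  obtains H where "variation_majorant (\<lambda>u. Qd \<delta> (r * cos u)) H (-2*pi) (2*pi)"
proof -
  let ?f = "\<lambda>u. Qd \<delta> (r * cos u)"
  have step: "Qd \<delta> (r * cos x) \<le> Qd \<delta> (r * cos y)" if "cos x \<le> cos y" for x y
    using that assms by (intro Qd_mono mult_left_mono) auto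
  have "variation_majorant ?f (\<lambda>x. - ?f x) 0 pi"
    by (intro antimono_variation_majorant step cos_monotone_0_pi_le) auto
  moreover have "variation_majorant ?f (\<lambda>x. - ?f x) (-2*pi) (-pi)"
  proof (intro antimono_variation_majorant step)
    fix x y assume "-2*pi \<le> x" "x \<le> y" "y \<le> -pi"
    then have "cos (y + 2*pi) \<le> cos (x + 2*pi)" by (intro cos_monotone_0_pi_le) auto
    then show "cos y \<le> cos x" by simp
  qed
  moreover have "variation_majorant ?f ?f (-pi) 0"
    by (intro mono_variation_majorant step cos_monotone_minus_pi_0') auto
  moreover have "variation_majorant ?f ?f pi (2*pi)"
  proof (intro mono_variation_majorant step)
    fix x y assume "pi \<le> x" "x \<le> y" "y \<le> 2*pi"
    then have "cos (x - 2*pi) \<le> cos (y - 2*pi)" by (intro cos_monotone_minus_pi_0') auto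
    then show "cos x \<le> cos y" by (simp add: cos_diff)
  qed
  ultimately obtain H1 H2 where "variation_majorant ?f H1 (-2*pi) 0" "variation_majorant ?f H2 0 (2*pi)"
    using variation_majorant_concat[where f = ?f] pi_ge_zero
    by (smt (verit, ccfv_threshold))
  then show ?thesis using variation_majorant_concat[where f = ?f] that by fastforce
qed

section \<open>The error in rotated coordinates\<close>

lemma frame_err_rotated:
  fixes r \<psi> \<delta> :: real and N :: nat
  defines "u \<equiv> \<lambda>j::nat. - \<psi> + real j * (2 * pi / real N)"
  shows "(frame_err \<delta> (polar_pt r \<psi>) N (harmonic_frame N))\<^sup>2 =
    (r - 2 / real N * (\<Sum>j=1..N. Qd \<delta> (r * cos (u j)) * cos (u j)))\<^sup>2
    + (2 / real N * (\<Sum>j=1..N. Qd \<delta> (r * cos (u j)) * sin (u j)))\<^sup>2"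
proof -
  define A B where "A = r - 2 / real N * (\<Sum>j=1..N. Qd \<delta> (r * cos (u j)) * cos (u j))"
    and "B = 2 / real N * (\<Sum>j=1..N. Qd \<delta> (r * cos (u j)) * sin (u j))"
  have \<theta>: "2 * real j * pi / real N = u j + \<psi>" for j by (simp add: u_def)
  have inner: "polar_pt r \<psi> \<bullet> harmonic_frame N j = r * cos (u j)" for j
  proof -
    have "polar_pt r \<psi> \<bullet> harmonic_frame N j = r * cos (u j + \<psi> - \<psi>)"
      unfolding polar_pt_def harmonic_frame_def \<theta> cos_diff
      by (simp add: inner_vec_def sum_2 algebra_simps)
    then show ?thesis by simp
  qed
  have frame: "harmonic_frame N j $ 1 = cos (u j + \<psi>)" "harmonic_frame N j $ 2 = sin (u j + \<psi>)" for j
    by (simp_all add: harmonic_frame_def flip: \<theta>)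
  let ?v = "polar_pt r \<psi> - (2 / real N) *\<^sub>R
      (\<Sum>j=1..N. Qd \<delta> (polar_pt r \<psi> \<bullet> harmonic_frame N j) *\<^sub>R harmonic_frame N j)"
  \<comment> \<open>The addition formulas show that the error vector is the image of
    \<open>(A, B)\<close> under a reflection depending on \<open>\<psi>\<close>, so its norm is that
    of \<open>(A, B)\<close>.\<close>
  have 1: "?v $ 1 = A * cos \<psi> + B * sin \<psi>"
    unfolding A_def B_def inner
    by (simp add: polar_pt_def frame cos_add algebra_simps
        sum_subtractf sum_distrib_left sum_distrib_right)
  have 2: "?v $ 2 = A * sin \<psi> - B * cos \<psi>"
    unfolding A_def B_def inner
    by (simp add: polar_pt_def frame sin_add algebra_simps
        sum.distrib sum_distrib_left sum_distrib_right)
  have "(norm v)\<^sup>2 = (v $ 1)\<^sup>2 + (v $ 2)\<^sup>2" for v :: "real^2"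
    unfolding power2_norm_eq_inner inner_vec_def sum_2 by (simp add: power2_eq_square)
  then have "(norm ?v)\<^sup>2 = (?v $ 1)\<^sup>2 + (?v $ 2)\<^sup>2" .
  also have "\<dots> = (A\<^sup>2 + B\<^sup>2) * ((sin \<psi>)\<^sup>2 + (cos \<psi>)\<^sup>2)"
    unfolding 1 2 by algebra
  finally show ?thesis by (simp add: frame_err_def A_def B_def)
qed

lemma integral_odd_real:
  fixes f :: "real \<Rightarrow> real"
  assumes "\<And>x. f (- x) = - f x"
  shows "integral {-a..a} f = 0"
proof -
  have "integral {-a..a} f = integral {-a..a} (\<lambda>x. - f x)"
    using Henstock_Kurzweil_Integration.integral_reflect_real[of a "-a" f] by (simp only: assms minus_minus)
  also have "\<dots> = - integral {-a..a} f" by (rule integral_neg)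
  finally show ?thesis by linarith
qed

lemma cos_lipschitz: "\<bar>cos x - cos y\<bar> \<le> \<bar>x - y\<bar>" for x y :: real
proof -
  have "\<bar>cos x - cos y\<bar> = 2 * \<bar>sin ((x + y) / 2)\<bar> * \<bar>sin ((y - x) / 2)\<bar>"
    by (simp add: cos_diff_cos abs_mult)
  also have "\<dots> \<le> 2 * 1 * \<bar>(y - x) / 2\<bar>"
    by (intro mult_mono abs_sin_x_le_abs_x) auto
  finally show ?thesis by simp
qed

lemma sin_lipschitz: "\<bar>sin x - sin y\<bar> \<le> \<bar>x - y\<bar>" for x y :: real
  using cos_lipschitz[of "pi/2 - x" "pi/2 - y"] by (simp add: cos_diff)

text \<open>Integrate \<open>Qd \<delta> t = t - Dd \<delta> t\<close> at
  \<open>t = r * cos \<theta>\<close> against \<open>cos \<theta>\<close>; the linear part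
  contributes \<open>r * pi\<close>. This turns the hypothesis on \<open>Dd\<close> into a value for
  the limit of the cosine sums.\<close>

lemma integral_Qd_cos:
  assumes "\<delta> > 0" "r > 0"
  shows "integral {-pi..pi} (\<lambda>\<theta>. Qd \<delta> (r * cos \<theta>) * cos \<theta>)
           = r * pi - integral {-pi..pi} (\<lambda>\<theta>. Dd \<delta> (r * cos \<theta>) * cos \<theta>)"
proof -
  have "r * (1 + (cos \<theta> * cos \<theta> - sin \<theta> * sin \<theta>)) / 2 = r * (cos \<theta>)\<^sup>2" for \<theta>
    by (simp add: sin_squared_eq flip: power2_eq_square)
  moreover have "((\<lambda>\<theta>. r * (\<theta> + sin \<theta> * cos \<theta>) / 2) has_real_derivative
      r * (1 + (cos \<theta> * cos \<theta> - sin \<theta> * sin \<theta>)) / 2) (at \<theta> within {-pi..pi})" for \<theta>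
    by (auto intro!: derivative_eq_intros)
  ultimately have "((\<lambda>\<theta>. r * (\<theta> + sin \<theta> * cos \<theta>) / 2) has_real_derivative r * (cos \<theta>)\<^sup>2)
      (at \<theta> within {-pi..pi})" for \<theta> by (simp only:)
  then have "((\<lambda>\<theta>. r * (cos \<theta>)\<^sup>2) has_integral
         (r * (pi + sin pi * cos pi) / 2 - r * (-pi + sin (-pi) * cos (-pi)) / 2)) {-pi..pi}"
    by (intro fundamental_theorem_of_calculus) (auto simp: has_real_derivative_iff_has_vector_derivative)
  then have "((\<lambda>\<theta>. r * (cos \<theta>)\<^sup>2 - Qd \<delta> (r * cos \<theta>) * cos \<theta>) has_integral
      (r * pi - integral {-pi..pi} (\<lambda>\<theta>. Qd \<delta> (r * cos \<theta>) * cos \<theta>))) {-pi..pi}"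
    using assms by (intro has_integral_diff integrable_integral Qd_cos_mult_integrable) (auto simp: mult.commute)
  moreover have "(\<lambda>\<theta>. r * (cos \<theta>)\<^sup>2 - Qd \<delta> (r * cos \<theta>) * cos \<theta>)
      = (\<lambda>\<theta>. Dd \<delta> (r * cos \<theta>) * cos \<theta>)"
    by (simp add: Dd_def power2_eq_square algebra_simps)
  ultimately have "integral {-pi..pi} (\<lambda>\<theta>. Dd \<delta> (r * cos \<theta>) * cos \<theta>)
      = r * pi - integral {-pi..pi} (\<lambda>\<theta>. Qd \<delta> (r * cos \<theta>) * cos \<theta>)"
    by (simp add: integral_unique)
  then show ?thesis by simp
qed

section \<open>Uniform O(1/N) bounds\<close>

text \<open>Treats \<open>g\<close> = \<open>cos\<close> and \<open>g\<close> = \<open>sin\<close>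
  together, with \<open>C\<close> independent of both \<open>\<psi>\<close> and \<open>N\<close>.
  The factor \<open>2 / real N\<close> is the step \<open>2*pi / real N\<close> divided by
  \<open>pi\<close>, which is why the integral is divided by \<open>pi\<close>.\<close>

lemma Qd_cos_riemann_sum:
  fixes r \<delta> :: real and g :: "real \<Rightarrow> real"
  assumes "\<delta> > 0" "r > 0"
    and g: "\<And>x. \<bar>g x\<bar> \<le> 1" "\<And>x y. \<bar>g x - g y\<bar> \<le> \<bar>x - y\<bar>" "\<And>x. g (x + 2*pi) = g x"
      "g \<in> borel_measurable borel"
  obtains C where "\<And>\<psi> N. 0 \<le> \<psi> \<Longrightarrow> \<psi> \<le> 2*pi \<Longrightarrow> N > 0 \<Longrightarrow>
    \<bar>2 / real N * (\<Sum>j=1..N. Qd \<delta> (r * cos (- \<psi> + real j * (2*pi / real N))) * g (- \<psi> + real j * (2*pi / real N)))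
       - integral {-pi..pi} (\<lambda>\<theta>. Qd \<delta> (r * cos \<theta>) * g \<theta>) / pi\<bar> \<le> C / real N"
proof -
  define f where "f = (\<lambda>u. Qd \<delta> (r * cos u) * g u)"
  obtain H0 where "variation_majorant (\<lambda>u. Qd \<delta> (r * cos u)) H0 (-2*pi) (2*pi)"
    using Qd_cos_majorant[OF assms(1,2)] .
  from variation_majorant_mult_lipschitz[OF this Qd_cos_abs_le[OF assms(1,2)] g(1,2)]
  obtain H where H: "variation_majorant f H (-2*pi) (2*pi)" unfolding f_def by blast
  have int: "f integrable_on {a..b}" for a b
    unfolding f_def using assms by (intro Qd_cos_mult_integrable) auto
  have per: "f (x + 2*pi) = f x" for x by (simp add: f_def g)
  show ?thesis
  proof (rule that[of "2 * (H (2*pi) - H (-2*pi))"])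
    fix \<psi> :: real and N :: nat assume \<psi>: "0 \<le> \<psi>" "\<psi> \<le> 2*pi" and N: "N > 0"
    define h S I where "h = 2*pi / real N" and "S = (\<Sum>j=1..N. f (- \<psi> + real j * h))"
      and "I = integral {-pi..pi} f"
    have Nh: "real N * h = 2*pi" using N by (simp add: h_def)
    have vm: "variation_majorant f H (-\<psi>) (-\<psi> + 2*pi)"
      using H \<psi> by (auto simp: variation_majorant_def)
    \<comment> \<open>The window starting at \<open>-2*pi\<close> is an intermediate stop: both
      \<open>-\<psi>\<close> and \<open>-pi\<close> lie at most one period to its right.\<close>
    have "integral {-\<psi>..-\<psi> + 2*pi} f = integral {-2*pi..-2*pi + 2*pi} f"
      using \<psi> by (intro integral_periodic_window per int) auto
    also have "\<dots> = integral {-pi..-pi + 2*pi} f"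
      by (intro integral_periodic_window[symmetric] per int) auto
    finally have "integral {-\<psi>..-\<psi> + 2*pi} f = I" by (simp add: I_def)
    then have "\<bar>h * S - I\<bar> \<le> h * (H (-\<psi> + 2*pi) - H (-\<psi>))"
      using riemann_sum_error[of h f H "-\<psi>" N] vm int unfolding S_def Nh by (simp add: h_def)
    \<comment> \<open>Replacing the growth over the window by the growth over the whole range
      removes the dependence on \<open>\<psi>\<close>.\<close>
    also have "\<dots> \<le> h * (H (2*pi) - H (-2*pi))"
      using variation_majorant_mono[OF H, of "-2*pi" "-\<psi>"]
        variation_majorant_mono[OF H, of "-\<psi> + 2*pi" "2*pi"] \<psi>
      by (intro mult_left_mono) (auto simp: h_def)
    finally have "\<bar>h * S - I\<bar> / pi \<le> h * (H (2*pi) - H (-2*pi)) / pi"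
      by (simp add: divide_right_mono)
    moreover have "h * (H (2*pi) - H (-2*pi)) / pi = 2 * (H (2*pi) - H (-2*pi)) / real N"
      by (simp add: h_def)
    moreover have "\<bar>h * S - I\<bar> / pi = \<bar>(h * S - I) / pi\<bar>" by simp
    moreover have "(h * S - I) / pi = 2 / real N * S - I / pi"
      by (simp add: h_def diff_divide_distrib)
    ultimately show "\<bar>2 / real N * (\<Sum>j=1..N. Qd \<delta> (r * cos (- \<psi> + real j * (2*pi / real N)))
        * g (- \<psi> + real j * (2*pi / real N)))
       - integral {-pi..pi} (\<lambda>\<theta>. Qd \<delta> (r * cos \<theta>) * g \<theta>) / pi\<bar> \<le> 2 * (H (2*pi) - H (-2*pi)) / real N"
      unfolding S_def I_def h_def f_def by (simp only:)
  qed
qed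

text \<open>Both rotated coordinates are at most a constant over \<open>N\<close>, uniformly in
  \<open>\<psi>\<close>; squaring, integrating over a range of length \<open>2*pi\<close> and taking
  the root keeps the order 1/N.\<close>

lemma circle_err_bigo:
  assumes pos: "\<delta> > 0" "r > 0"
    and zero: "integral {-pi..pi} (\<lambda>\<theta>. Dd \<delta> (r * cos \<theta>) * cos \<theta>) = 0"
  shows "(\<lambda>N. circle_err \<delta> r N (harmonic_frame N)) \<in> O(\<lambda>N. 1 / real N)"
proof -
  have c: "integral {-pi..pi} (\<lambda>\<theta>. Qd \<delta> (r * cos \<theta>) * cos \<theta>) / pi = r"
    using integral_Qd_cos[OF pos] zero by simp
  have s: "integral {-pi..pi} (\<lambda>\<theta>. Qd \<delta> (r * cos \<theta>) * sin \<theta>) / pi = 0"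
    by (simp add: integral_odd_real)
  obtain C1 where C1: "\<And>\<psi> N. 0 \<le> \<psi> \<Longrightarrow> \<psi> \<le> 2*pi \<Longrightarrow> N > 0 \<Longrightarrow>
    \<bar>2 / real N * (\<Sum>j=1..N. Qd \<delta> (r * cos (- \<psi> + real j * (2*pi / real N))) * cos (- \<psi> + real j * (2*pi / real N)))
       - r\<bar> \<le> C1 / real N"
    by (rule Qd_cos_riemann_sum[OF pos, of cos, unfolded c]) (auto intro: cos_lipschitz)
  obtain C2 where C2: "\<And>\<psi> N. 0 \<le> \<psi> \<Longrightarrow> \<psi> \<le> 2*pi \<Longrightarrow> N > 0 \<Longrightarrow>
    \<bar>2 / real N * (\<Sum>j=1..N. Qd \<delta> (r * cos (- \<psi> + real j * (2*pi / real N))) * sin (- \<psi> + real j * (2*pi / real N)))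
       - 0\<bar> \<le> C2 / real N"
    by (rule Qd_cos_riemann_sum[OF pos, of sin, unfolded s]) (auto intro: sin_lipschitz)
  have "circle_err \<delta> r N (harmonic_frame N) \<le> sqrt (2*pi * (C1\<^sup>2 + C2\<^sup>2)) * (1 / real N)" if N: "N > 0" for N
  proof -
    let ?F = "\<lambda>\<psi>. (frame_err \<delta> (polar_pt r \<psi>) N (harmonic_frame N))\<^sup>2"
    define B where "B = (C1\<^sup>2 + C2\<^sup>2) / (real N)\<^sup>2"
    have sq: "x\<^sup>2 \<le> (C / real N)\<^sup>2" if "\<bar>x\<bar> \<le> C / real N" for x C :: real
      using that abs_le_square_iff[of x "C / real N"] by linarith
    have F: "?F \<psi> \<le> B" if "\<psi> \<in> {0..2*pi}" for \<psi>
      using sq[OF C1[of \<psi> N]] sq[OF C2[of \<psi> N]] that N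
      by (simp add: frame_err_rotated B_def add_divide_distrib power_divide power2_commute)
    \<comment> \<open>A nonintegrable function has integral 0 by default, which also lies below the
      nonnegative bound.\<close>
    have "integral {0..2*pi} ?F \<le> 2*pi * B"
    proof (cases "?F integrable_on {0..2*pi}")
      case True
      then have "integral {0..2*pi} ?F \<le> integral {0..2*pi} (\<lambda>_. B)"
        using F by (intro integral_le) auto
      then show ?thesis by simp
    next
      case False
      then show ?thesis by (simp add: not_integrable_integral B_def)
    qed
    then have "circle_err \<delta> r N (harmonic_frame N) \<le> sqrt (2*pi * B)"
      by (simp add: circle_err_def)
    also have "\<dots> = sqrt (2*pi * (C1\<^sup>2 + C2\<^sup>2)) * (1 / real N)"
      by (simp add: B_def real_sqrt_divide)
    finally show ?thesis .
  qed
  moreover have "circle_err \<delta> r N (harmonic_frame N) \<ge> 0" for N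
    unfolding circle_err_def
    by (cases "(\<lambda>\<psi>. (frame_err \<delta> (polar_pt r \<psi>) N (harmonic_frame N))\<^sup>2) integrable_on {0..2*pi}")
      (auto intro!: Henstock_Kurzweil_Integration.integral_nonneg simp: not_integrable_integral)
  ultimately show ?thesis
    by (intro bigoI[of _ "sqrt (2*pi * (C1\<^sup>2 + C2\<^sup>2))"] eventually_mono[OF eventually_gt_at_top[of 0]])
      auto
qed

section \<open>The three-level regime and the critical ratio\<close>

lemma Qd_eqI:
  assumes "\<delta> > 0" "(of_int k - 1/2) * \<delta> \<le> t" "t < (of_int k + 1/2) * \<delta>"
  shows "Qd \<delta> t = of_int k * \<delta>"
proof -
  have "\<lfloor>t / \<delta> + 1/2\<rfloor> = k"
    using assms by (intro floor_unique) (auto simp: field_simps)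
  then show ?thesis by (simp add: Qd_def)
qed

text \<open>The value is prescribed only in the open interval because the endpoints will be jumps of
  the quantizer; they do not affect the integral.\<close>

lemma has_integral_Qd_cos_piece:
  assumes "a \<le> b" "\<And>\<theta>. a < \<theta> \<Longrightarrow> \<theta> < b \<Longrightarrow> Qd \<delta> (r * cos \<theta>) = c"
  shows "((\<lambda>\<theta>. Qd \<delta> (r * cos \<theta>) * cos \<theta>) has_integral (c * (sin b - sin a))) {a..b}"
proof -
  have "((\<lambda>\<theta>. c * cos \<theta>) has_integral (c * sin b - c * sin a)) {a..b}"
    using assms(1) by (intro fundamental_theorem_of_calculus)
      (auto intro!: derivative_eq_intros simp flip: has_real_derivative_iff_has_vector_derivative)
  then have "((\<lambda>\<theta>. c * cos \<theta>) has_integral (c * (sin b - sin a))) (cbox a b)"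
    by (simp add: right_diff_distrib)
  then have "((\<lambda>\<theta>. Qd \<delta> (r * cos \<theta>) * cos \<theta>) has_integral (c * (sin b - sin a))) (cbox a b)"
    by (rule has_integral_spike_interior) (simp add: assms(2))
  then show ?thesis by simp
qed

text \<open>The jumps are at \<open>\<alpha>\<close> and \<open>pi - \<alpha>\<close> and their
  negatives, where \<open>r * cos \<alpha> = \<delta> / 2\<close>. The lower bound on
  \<open>r\<close> gives \<open>0 < \<alpha> < pi / 2\<close>; the upper bound keeps rounding within
  \<open>-\<delta>\<close>, 0, \<open>\<delta>\<close>. The middle arc contributes
  \<open>2 * \<delta> * sin \<alpha>\<close>, and so do the two end arcs together.\<close>

lemma has_integral_Qd_cos_three_levels:
  assumes \<delta>: "\<delta> > 0" and r: "\<delta> / 2 < r" "r < 3 * \<delta> / 2"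
  shows "((\<lambda>\<theta>. Qd \<delta> (r * cos \<theta>) * cos \<theta>) has_integral (4 * \<delta> * sqrt (1 - (\<delta> / (2 * r))\<^sup>2))) {-pi..pi}"
proof -
  define \<alpha> where "\<alpha> = arccos (\<delta> / (2 * r))"
  have r0: "r > 0" using assms by linarith
  have q: "0 < \<delta> / (2 * r)" "\<delta> / (2 * r) < 1" using assms r0 by (auto simp: field_simps)
  have cosa: "cos \<alpha> = \<delta> / (2 * r)" and sina: "sin \<alpha> = sqrt (1 - (\<delta> / (2 * r))\<^sup>2)"
    using q by (auto simp: \<alpha>_def sin_arccos)
  have "\<alpha> < arccos 0" "0 < \<alpha>"
    using q arccos_less_arccos[of 0 "\<delta> / (2 * r)"] arccos_less_arccos[of "\<delta> / (2 * r)" 1]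
    by (auto simp: \<alpha>_def)
  then have \<alpha>: "0 < \<alpha>" "\<alpha> < pi / 2" by auto
  have rc: "r * cos \<alpha> = \<delta> / 2" using r0 by (simp add: cosa)
  have less: "r * cos x < r * cos y" if "cos x < cos y" for x y
    using that r0 by simp
  have up: "r * cos x \<le> r" "- r \<le> r * cos x" for x
    using r0 mult_left_mono[of "cos x" 1 r] mult_left_mono[of "-1" "cos x" r] by auto
  have high: "Qd \<delta> (r * cos \<theta>) = \<delta>" if "\<bar>\<theta>\<bar> < \<alpha>" for \<theta>
  proof -
    have "cos \<alpha> < cos \<bar>\<theta>\<bar>" using that \<alpha> by (intro cos_monotone_0_pi) auto
    then have "\<delta> / 2 < r * cos \<theta>" using less[of \<alpha> \<theta>] rc by simp
    then show ?thesis using Qd_eqI[of \<delta> 1 "r * cos \<theta>"] \<delta> r up[of \<theta>] by auto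
  qed
  have mid: "Qd \<delta> (r * cos \<theta>) = 0" if "\<alpha> < \<bar>\<theta>\<bar>" "\<bar>\<theta>\<bar> < pi - \<alpha>" for \<theta>
  proof -
    have "cos \<bar>\<theta>\<bar> < cos \<alpha>" "cos (pi - \<alpha>) < cos \<bar>\<theta>\<bar>"
      using that \<alpha> by (auto intro!: cos_monotone_0_pi simp del: cos_abs_real cos_pi_minus)
    then have "r * cos \<theta> < \<delta> / 2" "- (\<delta> / 2) < r * cos \<theta>"
      using less[of \<theta> \<alpha>] less[of "pi - \<alpha>" \<theta>] rc by auto
    then show ?thesis using Qd_eqI[of \<delta> 0 "r * cos \<theta>"] \<delta> by auto
  qed
  have low: "Qd \<delta> (r * cos \<theta>) = - \<delta>" if "pi - \<alpha> < \<bar>\<theta>\<bar>" "\<bar>\<theta>\<bar> < pi" for \<theta>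
  proof -
    have "cos \<bar>\<theta>\<bar> < cos (pi - \<alpha>)"
      using that \<alpha> by (intro cos_monotone_0_pi) auto
    then have "r * cos \<theta> < - (\<delta> / 2)"
      using less[of \<theta> "pi - \<alpha>"] rc by auto
    then show ?thesis using Qd_eqI[of \<delta> "-1" "r * cos \<theta>"] \<delta> r up[of \<theta>] by auto
  qed
  let ?f = "\<lambda>\<theta>. Qd \<delta> (r * cos \<theta>) * cos \<theta>"
  have 1: "(?f has_integral (- \<delta> * (sin (-(pi - \<alpha>)) - sin (-pi)))) {-pi..-(pi - \<alpha>)}"
    using \<alpha> by (intro has_integral_Qd_cos_piece low) auto
  have 2: "(?f has_integral (0 * (sin (-\<alpha>) - sin (-(pi - \<alpha>))))) {-(pi - \<alpha>)..-\<alpha>}"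
    using \<alpha> by (intro has_integral_Qd_cos_piece mid) auto
  have 3: "(?f has_integral (\<delta> * (sin \<alpha> - sin (-\<alpha>)))) {-\<alpha>..\<alpha>}"
    using \<alpha> by (intro has_integral_Qd_cos_piece high) auto
  have 4: "(?f has_integral (0 * (sin (pi - \<alpha>) - sin \<alpha>))) {\<alpha>..pi - \<alpha>}"
    using \<alpha> by (intro has_integral_Qd_cos_piece mid) auto
  have 5: "(?f has_integral (- \<delta> * (sin pi - sin (pi - \<alpha>)))) {pi - \<alpha>..pi}"
    using \<alpha> by (intro has_integral_Qd_cos_piece low) auto
  note 12 = has_integral_combine[OF _ _ 1 2]
  note 123 = has_integral_combine[OF _ _ 12 3]
  note 1234 = has_integral_combine[OF _ _ 123 4]
  note 12345 = has_integral_combine[OF _ _ 1234 5]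
  have "- \<delta> * (sin (-(pi - \<alpha>)) - sin (-pi)) + 0 * (sin (-\<alpha>) - sin (-(pi - \<alpha>))) + \<delta> * (sin \<alpha> - sin (-\<alpha>))
      + 0 * (sin (pi - \<alpha>) - sin \<alpha>) + - \<delta> * (sin pi - sin (pi - \<alpha>)) = 4 * \<delta> * sin \<alpha>"
    by simp
  with 12345 show ?thesis using \<alpha> unfolding sina[symmetric] by (simp add: mult.assoc)
qed

text \<open>Squaring the last equation and clearing denominators gives
  \<open>pi^2 * s^4 - 16 * s^2 + 4 = 0\<close>, with roots
  \<open>s^2 = (8 \<plusminus> 2 * w) / pi^2\<close> for
  \<open>w = sqrt (16 - pi^2)\<close>.\<close>

lemma critical_ratio:
  fixes s :: real
  assumes "s = sqrt (8 - 2 * sqrt (16 - pi\<^sup>2)) / pi"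
  shows "1/2 < s" "s < 3/2" "s * pi = 4 * sqrt (1 - (1 / (2 * s))\<^sup>2)"
proof -
  define w where "w = sqrt (16 - pi\<^sup>2)"
  have pi: "3 < pi" "pi < 4" using pi_gt3 pi_less_4 by auto
  have pi2: "9 < pi\<^sup>2" "pi\<^sup>2 < 16"
    using power_strict_mono[OF pi(1), of 2] power_strict_mono[OF pi(2), of 2] by auto
  have w: "w\<^sup>2 = 16 - pi\<^sup>2" "0 \<le> w" using pi2 by (auto simp: w_def)
  \<comment> \<open>Tangent bound for \<open>sqrt (16 - x)\<close> at \<open>x = 0\<close>; after
    squaring, the surplus is \<open>pi^4 / 64\<close>. It yields \<open>s > 1/2\<close>.\<close>
  have "w < 4 - pi\<^sup>2 / 8"
  proof (rule power2_less_imp_less)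
    show "w\<^sup>2 < (4 - pi\<^sup>2 / 8)\<^sup>2" unfolding w using pi by (simp add: power2_eq_square algebra_simps)
    show "0 \<le> 4 - pi\<^sup>2 / 8" using pi2 by simp
  qed
  then have w8: "pi\<^sup>2 / 4 < 8 - 2 * w" by simp
  have s: "s = sqrt (8 - 2 * w) / pi" using assms by (simp add: w_def)
  have s0: "s > 0" using w8 pi2 by (auto simp: s)
  have s2: "s\<^sup>2 * pi\<^sup>2 = 8 - 2 * w" using w8 pi2 by (simp add: s power_divide)
  have "(1/2)\<^sup>2 * pi\<^sup>2 < s\<^sup>2 * pi\<^sup>2" using s2 w8 by (simp add: power2_eq_square)
  then have "(1/2)\<^sup>2 < s\<^sup>2" by simp
  then show s_gt: "1/2 < s" using s0 by (intro power2_less_imp_less[of "1/2" s]) auto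
  \<comment> \<open>Here \<open>8 - 2 * w \<le> 8\<close>, while the right side exceeds
    \<open>81/4\<close> because \<open>pi > 3\<close>.\<close>
  have "s\<^sup>2 * pi\<^sup>2 < (3/2)\<^sup>2 * pi\<^sup>2" using s2 w(2) pi2 by (simp add: power2_eq_square)
  then have "s\<^sup>2 < (3/2)\<^sup>2" by simp
  then show "s < 3/2" using s0 by (intro power2_less_imp_less[of s "3/2"]) auto
  \<comment> \<open>Both sides equal \<open>(2 * w)^2\<close>; expanding and cancelling
    \<open>pi^2\<close> recovers the quadratic in \<open>s^2\<close>.\<close>
  have "(8 - s\<^sup>2 * pi\<^sup>2)\<^sup>2 = 4 * (16 - pi\<^sup>2)" using s2 w by (simp add: power2_eq_square)
  then have "pi\<^sup>2 * ((s\<^sup>2)\<^sup>2 * pi\<^sup>2) = pi\<^sup>2 * (16 * s\<^sup>2 - 4)"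
    by (simp add: power2_eq_square algebra_simps)
  then have q: "(s\<^sup>2)\<^sup>2 * pi\<^sup>2 = 16 * s\<^sup>2 - 4" using pi by simp
  have "(s * pi)\<^sup>2 = 16 * (1 - (1 / (2 * s))\<^sup>2)"
    using q s0 by (simp add: power2_eq_square field_simps)
  then have "sqrt ((s * pi)\<^sup>2) = sqrt 16 * sqrt (1 - (1 / (2 * s))\<^sup>2)"
    by (simp only: real_sqrt_mult)
  moreover have "sqrt 16 = 4" by (simp add: real_sqrt_unique)
  ultimately show "s * pi = 4 * sqrt (1 - (1 / (2 * s))\<^sup>2)"
    using s0 pi by simp
qed

theorem theorem1p2:
  shows "(\<forall>r \<delta>. r > 0 \<longrightarrow> \<delta> > 0 \<longrightarrow>
            integral {-pi..pi} (\<lambda>\<theta>. Dd \<delta> (r * cos \<theta>) * cos \<theta>) = 0 \<longrightarrow>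
            (\<lambda>N. circle_err \<delta> r N (harmonic_frame N)) \<in> O(\<lambda>N. 1 / real N))
       \<and> (\<forall>r \<delta>. r > 0 \<longrightarrow> \<delta> > 0 \<longrightarrow>
            r / \<delta> = sqrt (8 - 2 * sqrt (16 - pi\<^sup>2)) / pi \<longrightarrow>
            integral {-pi..pi} (\<lambda>\<theta>. Dd \<delta> (r * cos \<theta>) * cos \<theta>) = 0)"
proof (intro conjI allI impI)
  fix r \<delta> :: real
  assume "r > 0" "\<delta> > 0" "integral {-pi..pi} (\<lambda>\<theta>. Dd \<delta> (r * cos \<theta>) * cos \<theta>) = 0"
  then show "(\<lambda>N. circle_err \<delta> r N (harmonic_frame N)) \<in> O(\<lambda>N. 1 / real N)"
    by (intro circle_err_bigo)
next
  fix r \<delta> :: real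
  assume pos: "r > 0" "\<delta> > 0" and "r / \<delta> = sqrt (8 - 2 * sqrt (16 - pi\<^sup>2)) / pi"
  note s = critical_ratio[OF this(3)]
  \<comment> \<open>The bounds on the ratio \<open>s = r / \<delta>\<close> are exactly the
    three-level regime. There the integral of \<open>Qd\<close> is \<open>\<delta>\<close> times the
    right side of the ratio equation, hence \<open>\<delta> * s * pi = r * pi\<close>.\<close>
  have "\<delta> / 2 < r" "r < 3 * \<delta> / 2" using s(1,2) pos by (auto simp: field_simps)
  from integral_unique[OF has_integral_Qd_cos_three_levels[OF pos(2) this]]
  have "integral {-pi..pi} (\<lambda>\<theta>. Qd \<delta> (r * cos \<theta>) * cos \<theta>) = \<delta> * (4 * sqrt (1 - (1 / (2 * (r / \<delta>)))\<^sup>2))"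
    by simp
  also have "\<dots> = r * pi" unfolding s(3)[symmetric] using pos by simp
  finally show "integral {-pi..pi} (\<lambda>\<theta>. Dd \<delta> (r * cos \<theta>) * cos \<theta>) = 0"
    using integral_Qd_cos[OF pos(2,1)] by simp
qed

end
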